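(* Let $(u_n)_{n\ge0}$ be a sequence of fuzzy numbers and let $\mu$ be a fuzzy number. If $(u_n)$ is Cesàro summable to $\mu$ and $nD(u_n,u_{n-1})=o(1)$ as $n\to\infty$, then the sequence $(u_n)$ converges to $\mu$.
   Context: A fuzzy number is a function $u:\mathbb{R}\to[0,1]$ that is normal ($u(t_0)=1$ for some $t_0$), fuzzy convex ($u(\lambda s+(1-\lambda)t)\ge\min\{u(s),u(t)\}$ for $s,t\in\mathbb{R}$, $\lambda\in[0,1]$), upper semicontinuous, and has compact support $\overline{\{t:u(t)>0\}}$. The set of fuzzy numbers is $E^1$. For $u\in E^1$ the $\alpha$-level set is $[u]_\alpha=\{t:u(t)\ge\alpha\}$ for $0<\alpha\le1$ and $[u]_0=\overline{\{t:u(t)>0\}}$; it is a compact interval, written $[u]_\alpha=[u^-_\alpha,u^+_\alpha]$. Addition and scalar multiplication ($k\in\mathbb{R}$) are defined by $[u+v]_\alpha=[u^-_\alpha+v^-_\alpha,\,u^+_\alpha+v^+_\alpha]$ and $[ku]_\alpha=k[u]_\alpha$ for all $\alpha\in[0,1]$. The metric on $E^1$ is $D(u,v)=\sup_{\alpha\in[0,1]}\max\{|u^-_\alpha-v^-_\alpha|,|u^+_\alpha-v^+_\alpha|\}$; convergence in $E^1$ is with respect to $D$. A sequence $(u_n)_{n\ge0}$ of fuzzy numbers is Cesàro summable to $\mu\in E^1$ if $\sigma_n=\frac{1}{n+1}\sum_{k=0}^n u_k$ converges to $\mu$. *)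

theory Defs
  imports "HOL-Analysis.Analysis" "HOL-Library.Landau_Symbols"
begin

definition is_fuzzy_number :: "(real \<Rightarrow> real) \<Rightarrow> bool" where
  "is_fuzzy_number u \<longleftrightarrow>
     range u \<subseteq> {0..1} \<and>
     (\<exists>t\<^sub>0. u t\<^sub>0 = 1) \<and>
     (\<forall>s t. \<forall>l\<in>{0..1}. u (l * s + (1 - l) * t) \<ge> min (u s) (u t)) \<and>
     (\<forall>t c. u t < c \<longrightarrow> (\<forall>\<^sub>F s in nhds t. u s < c)) \<and> \<comment> \<open>upper semicontinuity\<close>
     compact (closure {t. u t > 0})"

lemma is_fuzzy_number_indicator: "is_fuzzy_number (\<lambda>t. if t = a then 1 else 0)"
proof -
  have "\<forall>\<^sub>F s in nhds t. (if s = a then 1 else (0::real)) < c"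
    if c: "(if t = a then 1 else 0) < c" for t c
  proof (cases "t = a")
    case True
    then show ?thesis using c by (intro always_eventually) auto
  next
    case False
    then have "\<forall>\<^sub>F s in nhds t. s \<noteq> a"
      by (intro t1_space_nhds)
    then show ?thesis
      by eventually_elim (use c False in auto)
  qed
  moreover have "{t. (if t = a then 1 else (0::real)) > 0} = {a}" by auto
  moreover have "min (if s = a then 1 else 0) (if t = a then 1 else (0::real))
      \<le> (if l * s + (1 - l) * t = a then 1 else 0)" for s t l :: real
    by (cases "s = a \<and> t = a") (auto simp: algebra_simps)
  ultimately show ?thesis
    unfolding is_fuzzy_number_def by (intro conjI allI ballI impI) auto
qed

typedef fuzzy_number = "{u. is_fuzzy_number u}"
  morphisms membership Abs_fuzzy_number
  using is_fuzzy_number_indicator by blast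

definition level :: "fuzzy_number \<Rightarrow> real \<Rightarrow> real set" where
  "level u \<alpha> = (if \<alpha> = 0 then closure {t. membership u t > 0} else {t. membership u t \<ge> \<alpha>})"

definition lower :: "fuzzy_number \<Rightarrow> real \<Rightarrow> real" where
  "lower u \<alpha> = Inf (level u \<alpha>)"

definition upper :: "fuzzy_number \<Rightarrow> real \<Rightarrow> real" where
  "upper u \<alpha> = Sup (level u \<alpha>)"

lemma fuzzy_membership: "is_fuzzy_number (membership u)"
  using membership by auto

lemma membership_nonneg: "membership u t \<ge> 0" and membership_le_1: "membership u t \<le> 1"
  using fuzzy_membership[of u] unfolding is_fuzzy_number_def
  by (metis atLeastAtMost_iff rangeI subsetD)+

lemma level_antimono:
  assumes "0 \<le> \<alpha>" "\<alpha> \<le> \<beta>"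
  shows "level u \<beta> \<subseteq> level u \<alpha>"
proof -
  have "{t. membership u t \<ge> \<beta>} \<subseteq> closure {t. membership u t > 0}" if "\<beta> > 0"
    using that by (intro order.trans[OF _ closure_subset]) auto
  then show ?thesis using assms by (auto simp: level_def)
qed

lemma level_eq_interval:
  assumes "\<alpha> \<in> {0..1}"
  shows "level u \<alpha> = {lower u \<alpha>..upper u \<alpha>}" and "lower u \<alpha> \<le> upper u \<alpha>"
proof -
  note fz = fuzzy_membership[of u, unfolded is_fuzzy_number_def]
  have conv_lev: "convex {t. membership u t \<ge> \<beta>}" for \<beta>
  proof (rule convexI)
    fix x y a b :: real
    assume A: "x \<in> {t. membership u t \<ge> \<beta>}" "y \<in> {t. membership u t \<ge> \<beta>}"
      "0 \<le> a" "0 \<le> b" "a + b = 1"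
    have "b = 1 - a" "a \<in> {0..1}" using A by auto
    then have "membership u (a * x + b * y) \<ge> min (membership u x) (membership u y)"
      using fz by blast
    then show "a *\<^sub>R x + b *\<^sub>R y \<in> {t. membership u t \<ge> \<beta>}" using A by auto
  qed
  have conv_supp: "convex {t. membership u t > 0}"
  proof (rule convexI)
    fix x y a b :: real
    assume A: "x \<in> {t. membership u t > 0}" "y \<in> {t. membership u t > 0}"
      "0 \<le> a" "0 \<le> b" "a + b = 1"
    have "b = 1 - a" "a \<in> {0..1}" using A by auto
    then have "membership u (a * x + b * y) \<ge> min (membership u x) (membership u y)"
      using fz by blast
    then show "a *\<^sub>R x + b *\<^sub>R y \<in> {t. membership u t > 0}" using A by auto
  qed
  have cl: "closed {t. membership u t \<ge> \<beta>}" for \<beta>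
  proof -
    have "open (- {t. membership u t \<ge> \<beta>})"
      unfolding open_subopen[of "- {t. membership u t \<ge> \<beta>}"]
    proof
      fix x assume "x \<in> - {t. membership u t \<ge> \<beta>}"
      then have "\<forall>\<^sub>F s in nhds x. membership u s < \<beta>" using fz by auto
      then show "\<exists>T. open T \<and> x \<in> T \<and> T \<subseteq> - {t. membership u t \<ge> \<beta>}"
        unfolding eventually_nhds by (metis ComplI mem_Collect_eq not_le subsetI)
    qed
    then show ?thesis by (simp add: closed_def)
  qed
  have "compact (level u 0)" using fz by (simp add: level_def)
  moreover have "closed (level u \<alpha>)" using cl by (simp add: level_def)
  moreover have "level u \<alpha> \<subseteq> level u 0" using assms by (intro level_antimono) auto
  ultimately have comp: "compact (level u \<alpha>)"
    by (metis compact_Int_closed inf.absorb_iff2)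
  have "convex (level u \<alpha>)"
    using conv_lev conv_supp by (simp add: level_def)
  then obtain a b where ab: "level u \<alpha> = {a..b}"
    using comp connected_compact_interval_1 convex_connected by metis
  obtain t where "membership u t = 1" using fz by blast
  then have "t \<in> level u 1" by (simp add: level_def)
  moreover have "level u 1 \<subseteq> level u \<alpha>" using assms by (intro level_antimono) auto
  ultimately have "a \<le> b" using ab by auto
  then show "level u \<alpha> = {lower u \<alpha>..upper u \<alpha>}" "lower u \<alpha> \<le> upper u \<alpha>"
    using ab by (simp_all add: lower_def upper_def)
qed

lemma lower_mono:
  assumes "0 \<le> \<alpha>" "\<alpha> \<le> \<beta>" "\<beta> \<le> 1"
  shows "lower u \<alpha> \<le> lower u \<beta>" and "upper u \<beta> \<le> upper u \<alpha>"
  using level_antimono[of \<alpha> \<beta> u] level_eq_interval[of \<alpha> u] level_eq_interval[of \<beta> u] assms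
  by auto

lemma in_level_iff: "\<alpha> > 0 \<Longrightarrow> t \<in> level u \<alpha> \<longleftrightarrow> membership u t \<ge> \<alpha>"
  by (simp add: level_def)

lemma fuzzy_number_eqI:
  assumes "\<And>\<alpha>. \<alpha> \<in> {0..1} \<Longrightarrow> level u \<alpha> = level v \<alpha>"
  shows "u = v"
proof -
  have *: "membership u t \<le> membership v t"
    if "\<And>\<alpha>. \<alpha> \<in> {0..1} \<Longrightarrow> level u \<alpha> = level v \<alpha>" for u v t
  proof (cases "membership u t > 0")
    case True
    then show ?thesis
      using that[of "membership u t"] in_level_iff[OF True] membership_le_1[of u t] by force
  next
    case False
    then show ?thesis using membership_nonneg[of v t] by linarith
  qed
  have "membership u = membership v"
    using *[of u v] *[of v u] assms by (intro ext antisym) auto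
  then show ?thesis by (simp add: membership_inject)
qed

lemma fuzzy_number_of_levels:
  fixes K :: "real \<Rightarrow> real set"
  assumes comp: "\<And>\<alpha>. \<alpha> \<in> {0..1} \<Longrightarrow> compact (K \<alpha>)"
    and conv: "\<And>\<alpha>. \<alpha> \<in> {0..1} \<Longrightarrow> convex (K \<alpha>)"
    and ne: "K 1 \<noteq> {}"
    and anti: "\<And>\<alpha> \<beta>. 0 \<le> \<alpha> \<Longrightarrow> \<alpha> \<le> \<beta> \<Longrightarrow> \<beta> \<le> 1 \<Longrightarrow> K \<beta> \<subseteq> K \<alpha>"
    and left: "\<And>\<alpha> t. 0 < \<alpha> \<Longrightarrow> \<alpha> \<le> 1 \<Longrightarrow> (\<And>\<beta>. 0 < \<beta> \<Longrightarrow> \<beta> < \<alpha> \<Longrightarrow> t \<in> K \<beta>) \<Longrightarrow> t \<in> K \<alpha>"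
    and zero: "K 0 \<subseteq> closure (\<Union>\<alpha>\<in>{0<..1}. K \<alpha>)"
  shows "\<exists>w. \<forall>\<alpha>\<in>{0..1}. level w \<alpha> = K \<alpha>"
proof -
  define A where "A t = insert 0 {\<alpha>\<in>{0<..1}. t \<in> K \<alpha>}" for t
  define w where "w t = Sup (A t)" for t
  have bdd: "bdd_above (A t)" for t
    by (rule bdd_aboveI[of _ 1]) (auto simp: A_def)
  have w0: "0 \<le> w t" for t
    unfolding w_def by (intro cSup_upper bdd) (auto simp: A_def)
  have w1: "w t \<le> 1" for t
    unfolding w_def by (intro cSup_least) (auto simp: A_def)
  have w_iff: "\<alpha> \<le> w t \<longleftrightarrow> t \<in> K \<alpha>" if \<alpha>: "0 < \<alpha>" "\<alpha> \<le> 1" for \<alpha> t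
  proof
    assume "t \<in> K \<alpha>"
    then show "\<alpha> \<le> w t"
      unfolding w_def by (intro cSup_upper bdd) (use \<alpha> in \<open>auto simp: A_def\<close>)
  next
    assume le: "\<alpha> \<le> w t"
    show "t \<in> K \<alpha>"
    proof (rule left[OF \<alpha>])
      fix \<beta> assume \<beta>: "0 < \<beta>" "\<beta> < \<alpha>"
      have "\<beta> < Sup (A t)" using \<beta> le by (simp add: w_def)
      moreover have "A t \<noteq> {}" by (auto simp: A_def)
      ultimately obtain \<gamma> where "\<gamma> \<in> A t" "\<beta> < \<gamma>"
        using less_cSup_iff[OF _ bdd] by blast
      then show "t \<in> K \<beta>" using \<beta> anti[of \<beta> \<gamma>] by (auto simp: A_def)
    qed
  qed
  have supp: "{t. w t > 0} = (\<Union>\<alpha>\<in>{0<..1}. K \<alpha>)"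
  proof (intro set_eqI iffI)
    fix t assume "t \<in> {t. w t > 0}"
    then show "t \<in> (\<Union>\<alpha>\<in>{0<..1}. K \<alpha>)"
      using w_iff[of "w t" t] w1[of t] by auto
  next
    fix t assume "t \<in> (\<Union>\<alpha>\<in>{0<..1}. K \<alpha>)"
    then obtain \<alpha> where "0 < \<alpha>" "\<alpha> \<le> 1" "t \<in> K \<alpha>" by auto
    then show "t \<in> {t. w t > 0}" using w_iff[of \<alpha> t] by auto
  qed
  have "(\<Union>\<alpha>\<in>{0<..1}. K \<alpha>) \<subseteq> K 0" by (intro UN_least anti) auto
  then have clsupp: "closure {t. w t > 0} = K 0"
    unfolding supp using zero comp[of 0] by (intro antisym closure_minimal compact_imp_closed) auto
  have "is_fuzzy_number w"
    unfolding is_fuzzy_number_def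
  proof (intro conjI allI ballI impI)
    show "range w \<subseteq> {0..1}" using w0 w1 by auto
    obtain t where "t \<in> K 1" using ne by auto
    then have "1 \<le> w t" using w_iff by auto
    then show "\<exists>t\<^sub>0. w t\<^sub>0 = 1" using w1[of t] by (auto intro!: exI[of _ t])
    show "compact (closure {t. w t > 0})" unfolding clsupp by (rule comp) auto
  next
    fix s t l :: real assume l: "l \<in> {0..1}"
    show "w (l * s + (1 - l) * t) \<ge> min (w s) (w t)"
    proof (cases "min (w s) (w t) > 0")
      case True
      define \<alpha> where "\<alpha> = min (w s) (w t)"
      have \<alpha>: "0 < \<alpha>" "\<alpha> \<le> 1" using True w1[of s] by (auto simp: \<alpha>_def)
      have "s \<in> K \<alpha>" "t \<in> K \<alpha>"
        using w_iff[OF \<alpha>, of s] w_iff[OF \<alpha>, of t] by (simp_all add: \<alpha>_def)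
      then have "l *\<^sub>R s + (1 - l) *\<^sub>R t \<in> K \<alpha>"
        using l \<alpha> by (intro convexD conv) auto
      then show ?thesis
        using w_iff[OF \<alpha>, of "l * s + (1 - l) * t"] unfolding \<alpha>_def by simp
    next
      case False
      then show ?thesis using w0[of "l * s + (1 - l) * t"] by linarith
    qed
  next
    fix t c assume c: "w t < c"
    show "\<forall>\<^sub>F s in nhds t. w s < c"
    proof (cases "c \<le> 1")
      case True
      have c0: "0 < c" using c w0[of t] by linarith
      have "t \<in> - K c" using w_iff[OF c0 True, of t] c by auto
      moreover have "open (- K c)" using comp[of c] c0 True by (simp add: compact_imp_closed open_Compl)
      ultimately have "\<forall>\<^sub>F s in nhds t. s \<in> - K c" by (rule eventually_nhds_in_open[rotated])
      then show ?thesis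
        by eventually_elim (use w_iff[OF c0 True] in \<open>auto simp: not_le[symmetric]\<close>)
    next
      case False
      show ?thesis
      proof (rule always_eventually, rule allI)
        fix s show "w s < c" using False w1[of s] by linarith
      qed
    qed
  qed
  then have mem: "membership (Abs_fuzzy_number w) = w"
    by (simp add: Abs_fuzzy_number_inverse)
  show ?thesis
  proof (intro exI ballI)
    fix \<alpha> :: real assume "\<alpha> \<in> {0..1}"
    then show "level (Abs_fuzzy_number w) \<alpha> = K \<alpha>"
      using clsupp w_iff[of \<alpha>] by (cases "\<alpha> = 0") (auto simp: level_def mem)
  qed
qed

text \<open>Both definite descriptions below denote: existence and uniqueness are established in
  \<open>level_plus\<close> and \<open>level_scaleR\<close>. The constant \<open>0\<close> is the crisp zero, the neutral element of
  addition, which makes finite sums available.\<close>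

instantiation fuzzy_number :: "{zero, plus, scaleR}"
begin

definition zero_fuzzy_number :: fuzzy_number where
  "0 = Abs_fuzzy_number (\<lambda>t. if t = 0 then 1 else 0)"

definition plus_fuzzy_number :: "fuzzy_number \<Rightarrow> fuzzy_number \<Rightarrow> fuzzy_number" where
  "u + v = (THE w. \<forall>\<alpha>\<in>{0..1}.
      level w \<alpha> = {lower u \<alpha> + lower v \<alpha> .. upper u \<alpha> + upper v \<alpha>})"

definition scaleR_fuzzy_number :: "real \<Rightarrow> fuzzy_number \<Rightarrow> fuzzy_number" where
  "k *\<^sub>R u = (THE w. \<forall>\<alpha>\<in>{0..1}. level w \<alpha> = (\<lambda>t. k * t) ` level u \<alpha>)"

instance ..

end

lemma lower_left_approx:
  assumes "0 < \<alpha>" "\<alpha> \<le> 1" "x < lower u \<alpha>"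
  shows "\<exists>\<beta>. 0 < \<beta> \<and> \<beta> < \<alpha> \<and> x < lower u \<beta>"
proof -
  have "x \<notin> level u \<alpha>" using assms level_eq_interval(1)[of \<alpha> u] by auto
  then have "max 0 (membership u x) < \<alpha>" using assms by (simp add: in_level_iff)
  then obtain \<beta> where \<beta>: "max 0 (membership u x) < \<beta>" "\<beta> < \<alpha>" using dense by blast
  then have "x \<notin> level u \<beta>" by (simp add: in_level_iff)
  moreover have "upper u \<alpha> \<le> upper u \<beta>" using \<beta> assms by (intro lower_mono) auto
  moreover have "lower u \<alpha> \<le> upper u \<alpha>" using assms by (intro level_eq_interval) auto
  ultimately show ?thesis
    using \<beta> assms level_eq_interval(1)[of \<beta> u] by (intro exI[of _ \<beta>]) auto
qed

lemma upper_left_approx: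
  assumes "0 < \<alpha>" "\<alpha> \<le> 1" "upper u \<alpha> < x"
  shows "\<exists>\<beta>. 0 < \<beta> \<and> \<beta> < \<alpha> \<and> upper u \<beta> < x"
proof -
  have "x \<notin> level u \<alpha>" using assms level_eq_interval(1)[of \<alpha> u] by auto
  then have "max 0 (membership u x) < \<alpha>" using assms by (simp add: in_level_iff)
  then obtain \<beta> where \<beta>: "max 0 (membership u x) < \<beta>" "\<beta> < \<alpha>" using dense by blast
  then have "x \<notin> level u \<beta>" by (simp add: in_level_iff)
  moreover have "lower u \<beta> \<le> lower u \<alpha>" using \<beta> assms by (intro lower_mono) auto
  moreover have "lower u \<alpha> \<le> upper u \<alpha>" using assms by (intro level_eq_interval) auto
  ultimately show ?thesis
    using \<beta> assms level_eq_interval(1)[of \<beta> u] by (intro exI[of _ \<beta>]) auto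
qed

lemma ex_plus:
  "\<exists>w. \<forall>\<alpha>\<in>{0..1}. level w \<alpha> = {lower u \<alpha> + lower v \<alpha> .. upper u \<alpha> + upper v \<alpha>}"
proof (rule fuzzy_number_of_levels)
  show "{lower u 1 + lower v 1..upper u 1 + upper v 1} \<noteq> {}"
    using level_eq_interval(2)[of 1 u] level_eq_interval(2)[of 1 v] by auto
next
  fix \<alpha> \<beta> :: real assume "0 \<le> \<alpha>" "\<alpha> \<le> \<beta>" "\<beta> \<le> 1"
  then show "{lower u \<beta> + lower v \<beta>..upper u \<beta> + upper v \<beta>} \<subseteq>
    {lower u \<alpha> + lower v \<alpha>..upper u \<alpha> + upper v \<alpha>}"
    using lower_mono[of \<alpha> \<beta> u] lower_mono[of \<alpha> \<beta> v] by auto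
next
  fix \<alpha> t :: real
  assume \<alpha>: "0 < \<alpha>" "\<alpha> \<le> 1"
    and t: "\<And>\<beta>. 0 < \<beta> \<Longrightarrow> \<beta> < \<alpha> \<Longrightarrow> t \<in> {lower u \<beta> + lower v \<beta>..upper u \<beta> + upper v \<beta>}"
  have "lower u \<alpha> + lower v \<alpha> \<le> t"
  proof (rule ccontr)
    assume "\<not> lower u \<alpha> + lower v \<alpha> \<le> t"
    define e where "e = (lower u \<alpha> + lower v \<alpha> - t) / 2"
    have e: "e > 0" using \<open>\<not> _\<close> by (simp add: e_def)
    obtain b where b: "0 < b" "b < \<alpha>" "lower u \<alpha> - e < lower u b"
      using lower_left_approx[OF \<alpha>, of "lower u \<alpha> - e" u] e by auto
    obtain c where c: "0 < c" "c < \<alpha>" "lower v \<alpha> - e < lower v c"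
      using lower_left_approx[OF \<alpha>, of "lower v \<alpha> - e" v] e by auto
    have "lower u b \<le> lower u (max b c)" "lower v c \<le> lower v (max b c)"
      using b c \<alpha> by (auto intro!: lower_mono)
    moreover have "lower u (max b c) + lower v (max b c) \<le> t"
      using t[of "max b c"] b c by auto
    ultimately have "lower u \<alpha> + lower v \<alpha> - 2 * e < t" using b c by linarith
    then show False by (simp add: e_def field_simps)
  qed
  moreover have "t \<le> upper u \<alpha> + upper v \<alpha>"
  proof (rule ccontr)
    assume "\<not> t \<le> upper u \<alpha> + upper v \<alpha>"
    define e where "e = (t - (upper u \<alpha> + upper v \<alpha>)) / 2"
    have e: "e > 0" using \<open>\<not> _\<close> by (simp add: e_def)
    obtain b where b: "0 < b" "b < \<alpha>" "upper u b < upper u \<alpha> + e"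
      using upper_left_approx[OF \<alpha>, of u "upper u \<alpha> + e"] e by auto
    obtain c where c: "0 < c" "c < \<alpha>" "upper v c < upper v \<alpha> + e"
      using upper_left_approx[OF \<alpha>, of v "upper v \<alpha> + e"] e by auto
    have "upper u (max b c) \<le> upper u b" "upper v (max b c) \<le> upper v c"
      using b c \<alpha> by (auto intro!: lower_mono)
    moreover have "t \<le> upper u (max b c) + upper v (max b c)"
      using t[of "max b c"] b c by auto
    ultimately have "t < upper u \<alpha> + upper v \<alpha> + 2 * e" using b c by linarith
    then show False by (simp add: e_def field_simps)
  qed
  ultimately show "t \<in> {lower u \<alpha> + lower v \<alpha>..upper u \<alpha> + upper v \<alpha>}" by simp
next
  show "{lower u 0 + lower v 0..upper u 0 + upper v 0} \<subseteq>
    closure (\<Union>\<alpha>\<in>{0<..1}. {lower u \<alpha> + lower v \<alpha>..upper u \<alpha> + upper v \<alpha>})"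
    (is "_ \<subseteq> closure ?U")
  proof
    fix x assume x: "x \<in> {lower u 0 + lower v 0..upper u 0 + upper v 0}"
    define s where "s = max (lower u 0) (x - upper v 0)"
    have "lower u 0 \<le> upper u 0" "lower v 0 \<le> upper v 0" by (auto intro!: level_eq_interval)
    then have "s \<in> level u 0" "x - s \<in> level v 0"
      using x by (auto simp: s_def level_eq_interval(1))
    then have s: "s \<in> closure {t. membership u t > 0}" "x - s \<in> closure {t. membership v t > 0}"
      by (auto simp: level_def)
    show "x \<in> closure ?U"
      unfolding closure_approachable
    proof (intro allI impI)
      fix e :: real assume "e > 0"
      then have "e / 2 > 0" by simp
      then obtain a where a: "membership u a > 0" "dist a s < e / 2"
        using s(1) unfolding closure_approachable by blast
      obtain b where b: "membership v b > 0" "dist b (x - s) < e / 2"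
        using s(2) \<open>e / 2 > 0\<close> unfolding closure_approachable by blast
      define \<alpha> where "\<alpha> = min (membership u a) (membership v b)"
      have \<alpha>: "0 < \<alpha>" "\<alpha> \<le> 1" using a b membership_le_1[of u a] by (auto simp: \<alpha>_def)
      have "a \<in> level u \<alpha>" "b \<in> level v \<alpha>" using \<alpha> by (auto simp: in_level_iff \<alpha>_def)
      then have "a + b \<in> {lower u \<alpha> + lower v \<alpha>..upper u \<alpha> + upper v \<alpha>}"
        using \<alpha> level_eq_interval(1)[of \<alpha> u] level_eq_interval(1)[of \<alpha> v] by auto
      then have "a + b \<in> ?U" using \<alpha> by auto
      moreover have "dist (a + b) x < e" using a(2) b(2) unfolding dist_real_def by linarith
      ultimately show "\<exists>y\<in>?U. dist y x < e" by blast
    qed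
  qed
qed auto

lemma ex_scaleR: "\<exists>w. \<forall>\<alpha>\<in>{0..1}. level w \<alpha> = (\<lambda>t. k * t) ` level u \<alpha>"
proof (rule fuzzy_number_of_levels)
  fix \<alpha> :: real assume \<alpha>: "\<alpha> \<in> {0..1}"
  show "compact ((\<lambda>t. k * t) ` level u \<alpha>)"
    using compact_scaling[of "level u \<alpha>" k] level_eq_interval(1)[OF \<alpha>, of u] by simp
  show "convex ((\<lambda>t. k * t) ` level u \<alpha>)"
    using convex_scaling[of "level u \<alpha>" k] level_eq_interval(1)[OF \<alpha>, of u] by simp
next
  show "(\<lambda>t. k * t) ` level u 1 \<noteq> {}"
    using level_eq_interval[of 1 u] by simp
next
  fix \<alpha> \<beta> :: real assume "0 \<le> \<alpha>" "\<alpha> \<le> \<beta>" "\<beta> \<le> 1"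
  then show "(\<lambda>t. k * t) ` level u \<beta> \<subseteq> (\<lambda>t. k * t) ` level u \<alpha>"
    by (intro image_mono level_antimono)
next
  fix \<alpha> t :: real
  assume \<alpha>: "0 < \<alpha>" "\<alpha> \<le> 1"
    and t: "\<And>\<beta>. 0 < \<beta> \<Longrightarrow> \<beta> < \<alpha> \<Longrightarrow> t \<in> (\<lambda>t. k * t) ` level u \<beta>"
  show "t \<in> (\<lambda>t. k * t) ` level u \<alpha>"
  proof (cases "k = 0")
    case True
    then have "t = 0" using t[of "\<alpha> / 2"] \<alpha> by auto
    moreover have "level u \<alpha> \<noteq> {}" using \<alpha> level_eq_interval[of \<alpha> u] by auto
    ultimately show ?thesis using True by auto
  next
    case False
    have "\<beta> \<le> membership u (t / k)" if "0 < \<beta>" "\<beta> < \<alpha>" for \<beta>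
      using t[OF that] that False by (auto simp: in_level_iff)
    then have "\<alpha> \<le> membership u (t / k)" by (rule dense_le_bounded[OF \<alpha>(1)])
    then have "t / k \<in> level u \<alpha>" using \<alpha> by (simp add: in_level_iff)
    then show ?thesis using False by (intro image_eqI[of _ _ "t / k"]) auto
  qed
next
  have "{t. membership u t > 0} \<subseteq> (\<Union>\<alpha>\<in>{0<..1}. level u \<alpha>)"
    using membership_le_1[of u] by (force simp: in_level_iff)
  then have "(\<lambda>t. k * t) ` {t. membership u t > 0} \<subseteq> (\<Union>\<alpha>\<in>{0<..1}. (\<lambda>t. k * t) ` level u \<alpha>)"
    by blast
  then have "closure ((\<lambda>t. k * t) ` {t. membership u t > 0})
    \<subseteq> closure (\<Union>\<alpha>\<in>{0<..1}. (\<lambda>t. k * t) ` level u \<alpha>)"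
    by (rule closure_mono)
  then show "(\<lambda>t. k * t) ` level u 0 \<subseteq> closure (\<Union>\<alpha>\<in>{0<..1}. (\<lambda>t. k * t) ` level u \<alpha>)"
    using closure_scaleR[of k "{t. membership u t > 0}"] by (simp add: level_def)
qed

lemma level_plus:
  assumes "\<alpha> \<in> {0..1}"
  shows "level (u + v) \<alpha> = {lower u \<alpha> + lower v \<alpha> .. upper u \<alpha> + upper v \<alpha>}"
proof -
  have "\<exists>!w. \<forall>\<alpha>\<in>{0..1}. level w \<alpha> = {lower u \<alpha> + lower v \<alpha> .. upper u \<alpha> + upper v \<alpha>}"
    using ex_plus[of u v] by (metis (no_types, lifting) fuzzy_number_eqI)
  from theI'[OF this] show ?thesis using assms by (simp add: plus_fuzzy_number_def)
qed

lemma level_scaleR: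
  fixes u :: fuzzy_number
  assumes "\<alpha> \<in> {0..1}"
  shows "level (k *\<^sub>R u) \<alpha> = (\<lambda>t. k * t) ` level u \<alpha>"
proof -
  have "\<exists>!w. \<forall>\<alpha>\<in>{0..1}. level w \<alpha> = (\<lambda>t. k * t) ` level u \<alpha>"
    using ex_scaleR[of k u] by (metis (no_types, lifting) fuzzy_number_eqI)
  from theI'[OF this] show ?thesis using assms by (simp add: scaleR_fuzzy_number_def)
qed

lemma level_zero: "\<alpha> \<in> {0..1} \<Longrightarrow> level 0 \<alpha> = {0}"
  by (auto simp: level_def zero_fuzzy_number_def Abs_fuzzy_number_inverse
      is_fuzzy_number_indicator)

lemma lower_zero: "\<alpha> \<in> {0..1} \<Longrightarrow> lower 0 \<alpha> = 0"
  and upper_zero: "\<alpha> \<in> {0..1} \<Longrightarrow> upper 0 \<alpha> = 0"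
  by (simp_all add: lower_def upper_def level_zero)

lemma lower_plus: "\<alpha> \<in> {0..1} \<Longrightarrow> lower (u + v) \<alpha> = lower u \<alpha> + lower v \<alpha>"
  and upper_plus: "\<alpha> \<in> {0..1} \<Longrightarrow> upper (u + v) \<alpha> = upper u \<alpha> + upper v \<alpha>"
  using level_eq_interval(2)[of \<alpha> u] level_eq_interval(2)[of \<alpha> v]
  by (simp_all add: lower_def[of "u + v"] upper_def[of "u + v"] level_plus)

lemma fuzzy_number_eqI':
  assumes "\<And>\<alpha>. \<alpha> \<in> {0..1} \<Longrightarrow> lower u \<alpha> = lower v \<alpha>"
    and "\<And>\<alpha>. \<alpha> \<in> {0..1} \<Longrightarrow> upper u \<alpha> = upper v \<alpha>"
  shows "u = v"
  using assms by (intro fuzzy_number_eqI) (simp add: level_eq_interval(1))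

instance fuzzy_number :: comm_monoid_add
  by standard (rule fuzzy_number_eqI'; simp add: lower_plus upper_plus lower_zero upper_zero)+

lemma bdd_above_dist_levels:
  "bdd_above ((\<lambda>\<alpha>. max \<bar>lower u \<alpha> - lower v \<alpha>\<bar> \<bar>upper u \<alpha> - upper v \<alpha>\<bar>) ` {0..1})"
proof (rule bdd_aboveI2)
  fix \<alpha> :: real assume \<alpha>: "\<alpha> \<in> {0..1}"
  show "max \<bar>lower u \<alpha> - lower v \<alpha>\<bar> \<bar>upper u \<alpha> - upper v \<alpha>\<bar>
    \<le> max (upper u 0) (upper v 0) - min (lower u 0) (lower v 0)"
    using \<alpha> lower_mono[of 0 \<alpha> u] lower_mono[of 0 \<alpha> v]
      level_eq_interval(2)[OF \<alpha>, of u] level_eq_interval(2)[OF \<alpha>, of v]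
    by auto
qed

instantiation fuzzy_number :: metric_space
begin

definition dist_fuzzy_number :: "fuzzy_number \<Rightarrow> fuzzy_number \<Rightarrow> real" where
  "dist u v = (SUP \<alpha>\<in>{0..1}. max \<bar>lower u \<alpha> - lower v \<alpha>\<bar> \<bar>upper u \<alpha> - upper v \<alpha>\<bar>)"

definition uniformity_fuzzy_number :: "(fuzzy_number \<times> fuzzy_number) filter" where
  "uniformity_fuzzy_number = (INF e\<in>{0<..}. principal {(x, y). dist x y < e})"

definition open_fuzzy_number :: "fuzzy_number set \<Rightarrow> bool" where
  "open_fuzzy_number S = (\<forall>x\<in>S. \<forall>\<^sub>F (x', y) in uniformity. x' = x \<longrightarrow> y \<in> S)"

instance
proof
  fix u v w :: fuzzy_number
  have up: "max \<bar>lower u \<alpha> - lower v \<alpha>\<bar> \<bar>upper u \<alpha> - upper v \<alpha>\<bar> \<le> dist u v"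
    if "\<alpha> \<in> {0..1}" for \<alpha> u v
    unfolding dist_fuzzy_number_def using that by (intro cSUP_upper bdd_above_dist_levels)
  show "dist u v = 0 \<longleftrightarrow> u = v"
  proof
    assume "dist u v = 0"
    then show "u = v"
      using up[of _ u v] by (intro fuzzy_number_eqI') fastforce+
  qed (simp add: dist_fuzzy_number_def)
  show "dist u v \<le> dist u w + dist v w"
    unfolding dist_fuzzy_number_def[of u v]
  proof (rule cSUP_least)
    fix \<alpha> :: real assume "\<alpha> \<in> {0..1}"
    from up[OF this, of u w] up[OF this, of v w]
    show "max \<bar>lower u \<alpha> - lower v \<alpha>\<bar> \<bar>upper u \<alpha> - upper v \<alpha>\<bar> \<le> dist u w + dist v w"
      by auto
  qed auto
qed (rule uniformity_fuzzy_number_def open_fuzzy_number_def)+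

end

definition cesaro_mean :: "(nat \<Rightarrow> fuzzy_number) \<Rightarrow> nat \<Rightarrow> fuzzy_number" where
  "cesaro_mean u n = (1 / (real n + 1)) *\<^sub>R (\<Sum>k=0..n. u k)"

definition cesaro_summable_to :: "(nat \<Rightarrow> fuzzy_number) \<Rightarrow> fuzzy_number \<Rightarrow> bool" where
  "cesaro_summable_to u \<mu> \<longleftrightarrow> cesaro_mean u \<longlonglongrightarrow> \<mu>"

end

theory Submission
  imports Defs
begin

text \<open>Averaging does not increase distances: the Cesaro mean \<open>\<sigma>\<^sub>n\<close> is the average of
  \<open>u\<^sub>0, \<dots>, u\<^sub>n\<close>, so \<open>D u\<^sub>n \<sigma>\<^sub>n\<close> is at most the average of the
  distances \<open>D u\<^sub>n u\<^sub>k\<close> for \<open>k \<le> n\<close> (lemma \<open>dist_cesaro_mean_le\<close>).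
  The triangle inequality bounds \<open>D u\<^sub>n u\<^sub>k\<close> by the sum of the
  steps \<open>d\<^sub>j = D u\<^sub>j u\<^bsub>j-1\<^esub>\<close> over \<open>k < j \<le> n\<close>. Summed over \<open>k\<close>, the step \<open>d\<^sub>j\<close> is counted
  once for each \<open>k < j\<close>, that is \<open>j\<close> times (lemma \<open>sum_dist_le_weighted_steps\<close>). Hence
  \<open>D u\<^sub>n \<sigma>\<^sub>n\<close> is at most the average of \<open>j d\<^sub>j\<close> over \<open>j \<le> n\<close>, which tends to \<open>0\<close>
  because the averages of a null sequence tend to \<open>0\<close> (lemma \<open>averages_tendsto_zero\<close>). So
  \<open>u\<^sub>n\<close> and \<open>\<sigma>\<^sub>n\<close> have the same limit. Fuzzy numbers have no additive inverses, so
  differences are formed only for the real endpoints of the level intervals.\<close>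

lemma dist_fuzzy_number_leI:
  assumes "\<And>\<alpha>. \<alpha> \<in> {0..1} \<Longrightarrow> \<bar>lower u \<alpha> - lower v \<alpha>\<bar> \<le> B"
    and "\<And>\<alpha>. \<alpha> \<in> {0..1} \<Longrightarrow> \<bar>upper u \<alpha> - upper v \<alpha>\<bar> \<le> B"
  shows "dist u v \<le> B"
  unfolding dist_fuzzy_number_def by (rule cSUP_least) (use assms in auto)

lemma endpoint_diff_le_dist:
  assumes "\<alpha> \<in> {0..1}"
  shows "\<bar>lower u \<alpha> - lower v \<alpha>\<bar> \<le> dist u v" and "\<bar>upper u \<alpha> - upper v \<alpha>\<bar> \<le> dist u v"
proof -
  have "max \<bar>lower u \<alpha> - lower v \<alpha>\<bar> \<bar>upper u \<alpha> - upper v \<alpha>\<bar> \<le> dist u v"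
    unfolding dist_fuzzy_number_def using assms by (intro cSUP_upper bdd_above_dist_levels)
  then show "\<bar>lower u \<alpha> - lower v \<alpha>\<bar> \<le> dist u v" "\<bar>upper u \<alpha> - upper v \<alpha>\<bar> \<le> dist u v"
    by auto
qed

lemma endpoint_scaleR_nonneg:
  assumes "0 \<le> k" "\<alpha> \<in> {0..1}"
  shows "lower (k *\<^sub>R u) \<alpha> = k * lower u \<alpha>" and "upper (k *\<^sub>R u) \<alpha> = k * upper u \<alpha>"
proof -
  have "level (k *\<^sub>R u) \<alpha> = {k * lower u \<alpha> .. k * upper u \<alpha>}"
    using assms level_eq_interval[OF assms(2), of u]
    by (cases "k = 0") (auto simp: level_scaleR image_mult_atLeastAtMost_if)
  moreover have "k * lower u \<alpha> \<le> k * upper u \<alpha>"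
    using assms level_eq_interval(2) by (intro mult_left_mono) auto
  ultimately show "lower (k *\<^sub>R u) \<alpha> = k * lower u \<alpha>" "upper (k *\<^sub>R u) \<alpha> = k * upper u \<alpha>"
    by (simp_all add: lower_def[of "k *\<^sub>R u"] upper_def[of "k *\<^sub>R u"])
qed

lemma endpoint_sum:
  assumes "\<alpha> \<in> {0..1}"
  shows "lower (\<Sum>k\<in>A. u k) \<alpha> = (\<Sum>k\<in>A. lower (u k) \<alpha>)"
    and "upper (\<Sum>k\<in>A. u k) \<alpha> = (\<Sum>k\<in>A. upper (u k) \<alpha>)"
  using assms
  by (induction A rule: infinite_finite_induct)
    (simp_all add: lower_plus upper_plus lower_zero upper_zero)

lemma abs_diff_average_le:
  fixes x :: real
  assumes "\<And>k. \<bar>x - y k\<bar> \<le> d k"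
  shows "\<bar>x - (1 / (real n + 1)) * (\<Sum>k=0..n. y k)\<bar> \<le> (\<Sum>k=0..n. d k) / (real n + 1)"
proof -
  have "x - (1 / (real n + 1)) * (\<Sum>k=0..n. y k) = (\<Sum>k=0..n. x - y k) / (real n + 1)"
    by (simp add: sum_subtractf field_simps)
  moreover have "\<bar>\<Sum>k=0..n. x - y k\<bar> \<le> (\<Sum>k=0..n. d k)"
    by (rule order.trans[OF sum_abs sum_mono]) (rule assms)
  ultimately show ?thesis
    by (simp add: divide_right_mono)
qed

text \<open>Both endpoints of the level intervals are additive and homogeneous for nonnegative
  factors, so the claim reduces to the corresponding estimate for averages of real numbers, with
  a bound that is uniform in the level.\<close>

lemma dist_cesaro_mean_le:
  "dist v (cesaro_mean u n) \<le> (\<Sum>k=0..n. dist v (u k)) / (real n + 1)"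
  by (rule dist_fuzzy_number_leI)
    (simp_all only: cesaro_mean_def endpoint_scaleR_nonneg endpoint_sum
      abs_diff_average_le endpoint_diff_le_dist divide_nonneg_nonneg zero_le_one
      of_nat_0_le_iff add_nonneg_nonneg)

text \<open>On passing from \<open>n\<close> to \<open>n + 1\<close> each of the \<open>n + 1\<close> distances \<open>dist (u n) (u k)\<close>
  grows by at most the new step \<open>dist (u (n + 1)) (u n)\<close>.\<close>

lemma sum_dist_le_weighted_steps:
  fixes u :: "nat \<Rightarrow> 'a::metric_space"
  shows "(\<Sum>k=0..n. dist (u n) (u k)) \<le> (\<Sum>k=0..n. real k * dist (u k) (u (k - 1)))"
proof (induction n)
  case 0
  then show ?case by simp
next
  case (Suc n)
  have "(\<Sum>k=0..Suc n. dist (u (Suc n)) (u k)) = (\<Sum>k=0..n. dist (u (Suc n)) (u k))"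
    by simp
  also have "\<dots> \<le> (\<Sum>k=0..n. dist (u (Suc n)) (u n) + dist (u n) (u k))"
    by (intro sum_mono dist_triangle)
  also have "\<dots> = real (Suc n) * dist (u (Suc n)) (u n) + (\<Sum>k=0..n. dist (u n) (u k))"
    by (simp add: sum.distrib)
  finally show ?case using Suc.IH by simp
qed

text \<open>This is the regularity of Cesaro summation for null sequences. Beyond an index \<open>N\<close> all
  terms are below \<open>e / 2\<close> and contribute less than \<open>e / 2\<close> to the average; the fixed
  initial sum is divided by \<open>n + 1\<close> and vanishes in the limit.\<close>

lemma averages_tendsto_zero:
  fixes a :: "nat \<Rightarrow> real"
  assumes "a \<longlonglongrightarrow> 0"
  shows "(\<lambda>n. (\<Sum>k=0..n. a k) / (real n + 1)) \<longlonglongrightarrow> 0"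
proof (rule LIMSEQ_I)
  fix e :: real assume "0 < e"
  then obtain N where N: "\<And>n. n \<ge> N \<Longrightarrow> \<bar>a n\<bar> < e / 2"
    using LIMSEQ_D[OF assms, of "e / 2"] by auto
  define C where "C = (\<Sum>k<N. \<bar>a k\<bar>)"
  obtain M :: nat where M: "2 * C / e < real M"
    using reals_Archimedean2 by blast
  have "\<bar>(\<Sum>k=0..n. a k) / (real n + 1)\<bar> < e" if "n \<ge> max N M" for n
  proof -
    have "\<bar>\<Sum>k=0..n. a k\<bar> \<le> (\<Sum>k=0..n. \<bar>a k\<bar>)"
      by (rule sum_abs)
    also have "\<dots> = C + (\<Sum>k=N..n. \<bar>a k\<bar>)"
    proof -
      have "{0..n} = {..<N} \<union> {N..n}" using that by auto
      then show ?thesis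
        unfolding C_def by (simp add: sum.union_disjoint Int_def)
    qed
    also have "(\<Sum>k=N..n. \<bar>a k\<bar>) \<le> (\<Sum>k=N..n. e / 2)"
      using N by (intro sum_mono) (auto intro: less_imp_le)
    also have "\<dots> \<le> (real n + 1) * (e / 2)"
      using \<open>0 < e\<close> by (auto intro!: mult_right_mono)
    also have "C < (real n + 1) * (e / 2)"
    proof -
      have "C < real M * (e / 2)"
        using M \<open>0 < e\<close> by (simp add: field_simps)
      also have "\<dots> \<le> (real n + 1) * (e / 2)"
        using that \<open>0 < e\<close> by (intro mult_right_mono) auto
      finally show ?thesis .
    qed
    finally show ?thesis
      by (simp add: field_simps)
  qed
  then show "\<exists>N. \<forall>n\<ge>N. norm ((\<Sum>k=0..n. a k) / (real n + 1) - 0) < e"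
    by (auto intro!: exI[of _ "max N M"])
qed

theorem corollary5p1:
  fixes u :: "nat \<Rightarrow> fuzzy_number" and \<mu> :: fuzzy_number
  assumes "cesaro_summable_to u \<mu>"
    and "(\<lambda>n. real n * dist (u n) (u (n - 1))) \<in> o(\<lambda>_. 1)"
  shows "u \<longlonglongrightarrow> \<mu>"
proof -
  define a where "a n = real n * dist (u n) (u (n - 1))" for n
  have "a \<longlonglongrightarrow> 0"
    using smalloD_tendsto[OF assms(2)] by (simp add: a_def[abs_def])
  then have avg: "(\<lambda>n. (\<Sum>k=0..n. a k) / (real n + 1)) \<longlonglongrightarrow> 0"
    by (rule averages_tendsto_zero)
  have bound: "dist (u n) (cesaro_mean u n) \<le> (\<Sum>k=0..n. a k) / (real n + 1)" for n
  proof -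
    have "dist (u n) (cesaro_mean u n) \<le> (\<Sum>k=0..n. dist (u n) (u k)) / (real n + 1)"
      by (rule dist_cesaro_mean_le)
    also have "\<dots> \<le> (\<Sum>k=0..n. a k) / (real n + 1)"
      unfolding a_def by (intro divide_right_mono sum_dist_le_weighted_steps) simp
    finally show ?thesis .
  qed
  have "(\<lambda>n. dist (u n) (cesaro_mean u n)) \<longlonglongrightarrow> 0"
    by (rule tendsto_sandwich[OF _ _ tendsto_const avg]) (simp_all add: bound)
  moreover have "(\<lambda>n. dist (cesaro_mean u n) \<mu>) \<longlonglongrightarrow> 0"
    using assms(1) unfolding cesaro_summable_to_def by (rule tendsto_dist_iff[THEN iffD1])
  ultimately have
    "(\<lambda>n. dist (u n) (cesaro_mean u n) + dist (cesaro_mean u n) \<mu>) \<longlonglongrightarrow> 0"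
    by (rule tendsto_add_zero)
  then have "(\<lambda>n. dist (u n) \<mu>) \<longlonglongrightarrow> 0"
    by (rule tendsto_sandwich[OF _ _ tendsto_const, rotated 2]) (simp_all add: dist_triangle)
  then show ?thesis
    by (rule tendsto_dist_iff[THEN iffD2])
qed

end
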